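(* If there exists a countable extremally disconnected Hausdorff Boolean topological group $G$ containing a family of open subgroups whose intersection has empty interior in $G$, then there exists a rapid ultrafilter on $\omega$.
   Context: A Boolean group is a group in which every element $x$ satisfies $x+x=\mathbf 0$ (written additively, with zero element $\mathbf 0$). A topological space is extremally disconnected if the closure of every open set is open. An ultrafilter $\mathcal U$ on $\omega$ is rapid if every function $f\colon\omega\to\omega$ is majorized by the increasing enumeration of some element of $\mathcal U$, i.e., there is an infinite $A\in\mathcal U$ with increasing enumeration $a_0<a_1<a_2<\dots$ such that $f(i)\le a_i$ for all $i\in\omega$. *)

theory Defs
  imports "HOL-Analysis.Abstract_Topological_Spaces" "HOL-Algebra.Coset"
    "HOL-Library.Infinite_Set" "HOL-Library.Countable_Set"
begin

locale boolean_group = group +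
  assumes square_eq_one: "x \<in> carrier G \<Longrightarrow> x \<otimes> x = \<one>"

locale topological_group = group +
  fixes T :: "'a topology"
  assumes topspace_eq_carrier: "topspace T = carrier G"
    and continuous_mult: "continuous_map (prod_topology T T) T (\<lambda>(x, y). x \<otimes> y)"
    and continuous_inv: "continuous_map T T (\<lambda>x. inv x)"

definition extremally_disconnected_space :: "'a topology \<Rightarrow> bool" where
  "extremally_disconnected_space T \<longleftrightarrow> (\<forall>U. openin T U \<longrightarrow> openin T (T closure_of U))"

definition open_subgroup :: "'a set \<Rightarrow> ('a, 'b) monoid_scheme \<Rightarrow> 'a topology \<Rightarrow> bool" where
  "open_subgroup H G T \<longleftrightarrow> subgroup H G \<and> openin T H"

definition ultrafilter :: "'a filter \<Rightarrow> bool" where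
  "ultrafilter F \<longleftrightarrow>
     F \<noteq> bot \<and> (\<forall>P. eventually P F \<or> eventually (\<lambda>x. \<not> P x) F)"

text \<open>A set \<open>A\<close> is an element of the filter \<open>F\<close> iff \<^term>\<open>eventually (\<lambda>n. n \<in> A) F\<close>.
  Nonprincipality is not required separately: since the set \<open>A\<close> below has to satisfy
  \<open>f 0 \<le> enumerate A 0\<close> for arbitrary \<open>f\<close>, rapidness excludes principal ultrafilters.\<close>

definition rapid_ultrafilter :: "nat filter \<Rightarrow> bool" where
  "rapid_ultrafilter F \<longleftrightarrow> ultrafilter F \<and>
     (\<forall>f :: nat \<Rightarrow> nat. \<exists>A. eventually (\<lambda>n. n \<in> A) F \<and> infinite A \<and> (\<forall>i. f i \<le> enumerate A i))"

end

theory Submission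
  imports Defs "HOL-Analysis.Abstract_Limits"
begin

text \<open>The group operation is thought of as vector addition over the field with two elements, with
  neutral element \<open>0\<close>. By Zorn's lemma every point outside the intersection of the given subgroups is
  missed by an open subgroup of index two, so there is a decreasing sequence of open subgroups \<open>L n\<close> of
  index at most \<open>2 ^ n\<close> whose intersection, the core, has empty interior.  Code the cosets of the core by
  natural numbers and push the filter of neighbourhoods of \<open>0\<close>, restricted to the complement of the
  core, forward to \<open>\<nat>\<close>.  If every function \<open>f\<close> admits a member of this filter with at most \<open>2 ^ n\<close>
  elements below \<open>f n\<close> for each \<open>n\<close>, then every finer ultrafilter is rapid.

  Otherwise some \<open>f\<close> is bad.  Every neighbourhood \<open>V\<close> of \<open>0\<close> then contains, for some \<open>n\<close>, more than
  \<open>2 ^ n\<close> points with distinct codes below \<open>f n\<close>, and two of them differ by an element of \<open>L n\<close>.  Hence the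
  set \<open>D\<close> of all such differences accumulates at \<open>0\<close>.  On the other hand \<open>D - L n\<close> meets only finitely
  many cosets of the core, so \<open>D\<close> converges to the core in the coarser topology given by the \<open>L n\<close>
  (\<open>exists_rapid_ultrafilter\<close>).  After thinning the filtration, points of \<open>D\<close> on the same level can be told
  apart two levels deeper, and one of the two parity classes of levels, call it \<open>E\<close>, still accumulates
  at \<open>0\<close> (\<open>rapid_ultrafilter_if_null_set_accumulates\<close>).

  Extremal disconnectedness is used twice, each time in the form that disjoint open sets have disjoint
  closures.  The level is locally constant off the core, so the levels of the points of \<open>E\<close> near \<open>0\<close>
  generate an ultrafilter on \<open>\<nat>\<close>.  This ultrafilter is Ramsey (\<open>level_filter_ramsey\<close>): a sum \<open>x + y\<close> with
  \<open>x, y \<in> E\<close> and \<open>level x < level y\<close>, even if blurred by an element of level above that of \<open>y\<close>, determines both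
  levels, so a colouring of pairs of levels splits these sums into two disjoint open sets, one of which
  misses a neighbourhood \<open>U\<close> of \<open>0\<close>; if \<open>V + V \<subseteq> U\<close>, the levels of \<open>V \<inter> E\<close> are homogeneous.  A Ramsey
  ultrafilter is rapid.\<close>

section \<open>Rapid ultrafilters from filters on the natural numbers\<close>

lemma ultrafilter_extension:
  fixes F :: "'a filter"
  assumes "F \<noteq> bot"
  shows "\<exists>U. ultrafilter U \<and> U \<le> F"
proof -
  define A where "A = {U. U \<noteq> bot \<and> U \<le> F}"
  define le :: "'a filter \<Rightarrow> 'a filter \<Rightarrow> bool" where "le = (\<lambda>U V. V \<le> U)"
  have "\<exists>m\<in>A. \<forall>a\<in>A. le m a \<longrightarrow> a = m"
  proof (rule predicate_Zorn)
    show "partial_order_on A (relation_of le A)"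
      by (auto simp: partial_order_on_def preorder_on_def refl_on_def trans_def antisym_def
          relation_of_def le_def)
  next
    fix C assume "C \<in> Chains (relation_of le A)"
    then have sub: "C \<subseteq> A" and lin: "\<And>U V. U \<in> C \<Longrightarrow> V \<in> C \<Longrightarrow> U \<le> V \<or> V \<le> U"
      by (auto simp: Chains_def relation_of_def le_def)
    \<comment> \<open>An infimum of a chain of proper filters is proper, as its events are the events of the members.\<close>
    show "\<exists>u\<in>A. \<forall>a\<in>C. le a u"
    proof (cases "C = {}")
      case True
      then show ?thesis using assms by (auto simp: A_def)
    next
      case False
      have "eventually P (Inf C) \<longleftrightarrow> (\<exists>U\<in>C. eventually P U)" for P
        using False lin by (intro eventually_Inf_base) (metis inf.absorb1 inf.absorb2 order_refl)+
      then have "Inf C \<noteq> bot"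
        using sub by (auto simp: trivial_limit_def A_def)
      moreover have "Inf C \<le> F"
        using False sub by (auto simp: A_def intro: Inf_lower2)
      ultimately show ?thesis
        by (auto simp: A_def le_def intro: Inf_lower)
    qed
  qed
  then obtain m where m: "m \<noteq> bot" "m \<le> F"
    and max: "\<And>a. a \<noteq> bot \<Longrightarrow> a \<le> F \<Longrightarrow> a \<le> m \<Longrightarrow> a = m"
    by (auto simp: A_def le_def)
  have "eventually P m" if "\<not> eventually (\<lambda>x. \<not> P x) m" for P
  proof -
    have "inf m (principal {x. P x}) \<noteq> bot"
      using that by (simp add: trivial_limit_def eventually_inf_principal)
    then have "inf m (principal {x. P x}) = m"
      using m(2) by (intro max) (auto intro: le_infI1)
    then have "m \<le> principal {x. P x}"
      by (metis inf.cobounded2)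
    then show ?thesis
      by (simp add: le_principal)
  qed
  then show ?thesis
    using m by (auto simp: ultrafilter_def)
qed

text \<open>The bound \<open>2 ^ n\<close> is as good as any other function of \<open>n\<close>, because \<open>f\<close> is arbitrary: to majorize a
  given function, apply the hypothesis to one that runs sufficiently far ahead of it.  The exponential bound is what the index of \<open>L n\<close>
  will provide.\<close>
lemma rapid_ultrafilter_if_slow_sets:
  assumes U: "ultrafilter U" "U \<le> sequentially"
    and slow: "\<And>f :: nat \<Rightarrow> nat. \<exists>A. eventually (\<lambda>k. k \<in> A) U \<and> (\<forall>n. card (A \<inter> {..<f n}) \<le> 2 ^ n)"
  shows "rapid_ultrafilter U"
  unfolding rapid_ultrafilter_def
proof (intro conjI allI U(1))
  fix f :: "nat \<Rightarrow> nat"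
  define F where "F i = (\<Sum>k\<le>i. f k)" for i
  have F_mono: "F i \<le> F j" if "i \<le> j" for i j
    unfolding F_def using that by (intro sum_mono2) auto
  have f_le: "f i \<le> F i" for i
    unfolding F_def by (rule member_le_sum) auto
  \<comment> \<open>Shifted argument: the indices \<open>i\<close> with \<open>2 ^ n \<le> i < 2 ^ Suc n\<close> are handled by the \<open>n\<close>-th bound.\<close>
  obtain A where A: "eventually (\<lambda>k. k \<in> A) U"
    and card: "\<And>n. card (A \<inter> {..<F (2 ^ Suc n)}) \<le> 2 ^ n"
    using slow[of "\<lambda>n. F (2 ^ Suc n)"] by blast
  \<comment> \<open>The truncation takes care of \<open>i = 0\<close>, which lies in none of the dyadic blocks.\<close>
  define B where "B = A \<inter> {F 0..}"
  have tail: "eventually (\<lambda>k. m \<le> k) U" for m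
    using U(2) by (simp add: filter_leD)
  have B: "eventually (\<lambda>k. k \<in> B) U"
    using A tail[of "F 0"] by eventually_elim (auto simp: B_def)
  have inf: "infinite B"
  proof
    assume "finite B"
    then obtain m where "B \<subseteq> {..<m}"
      by (meson finite_nat_iff_bounded)
    with eventually_conj[OF B tail[of m]] have "eventually (\<lambda>k. False) U"
      by (auto elim!: eventually_mono)
    then show False
      using U(1) by (simp add: ultrafilter_def)
  qed
  have "f i \<le> enumerate B i" for i
  proof (cases "i = 0")
    case True
    then show ?thesis
      using enumerate_in_set[OF inf, of 0] f_le[of 0] by (auto simp: B_def)
  next
    case False
    then obtain n where n: "2 ^ n \<le> i" "i < 2 ^ (n + 1)"
      using ex_power_ivl1[of 2 i] by auto
    show ?thesis
    proof (rule ccontr)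
      assume "\<not> f i \<le> enumerate B i"
      then have "enumerate B i < F (2 ^ Suc n)"
        using f_le[of i] F_mono[of i "2 ^ Suc n"] n by simp
      moreover have "enumerate B j \<le> enumerate B i" if "j \<le> i" for j
        using inf that by simp
      ultimately have "enumerate B ` {..i} \<subseteq> A \<inter> {..<F (2 ^ Suc n)}"
        using enumerate_in_set[OF inf] by (fastforce simp: B_def)
      then have "card (enumerate B ` {..i}) \<le> card (A \<inter> {..<F (2 ^ Suc n)})"
        by (intro card_mono) auto
      moreover have "card (enumerate B ` {..i}) = Suc i"
        using inj_enumerate[OF inf] by (simp add: card_image inj_on_subset)
      ultimately show False
        using card[of n] n by simp
    qed
  qed
  then show "\<exists>A. eventually (\<lambda>k. k \<in> A) U \<and> infinite A \<and> (\<forall>i. f i \<le> enumerate A i)"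
    using B inf by blast
qed

text \<open>Cut \<open>\<nat>\<close> into finite intervals with end points growing faster than \<open>f\<close> and colour a pair by whether it lies
  within one interval.  An unbounded set cannot lie within one interval, so the homogeneous set picks
  at most one point from each.\<close>
lemma rapid_ultrafilter_if_ramsey:
  assumes U: "ultrafilter U" "U \<le> sequentially"
    and ramsey: "\<And>P. \<exists>A. eventually (\<lambda>k. k \<in> A) U \<and>
      ((\<forall>j\<in>A. \<forall>k\<in>A. j < k \<longrightarrow> P j k) \<or> (\<forall>j\<in>A. \<forall>k\<in>A. j < k \<longrightarrow> \<not> P j k))"
  shows "rapid_ultrafilter U"
proof (rule rapid_ultrafilter_if_slow_sets[OF U])
  fix f :: "nat \<Rightarrow> nat"
  define g where "g n = Suc n + (\<Sum>k\<le>n. f k)" for n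
  have g_mono: "g m \<le> g n" if "m \<le> n" for m n
    unfolding g_def using that by (intro add_mono sum_mono2) auto
  have f_le: "f n \<le> g n" for n
    unfolding g_def by (rule trans_le_add2, rule member_le_sum) auto
  have g_gt: "n < g n" for n
    by (simp add: g_def)
  obtain A where A: "eventually (\<lambda>k. k \<in> A) U"
    and hom: "(\<forall>j\<in>A. \<forall>k\<in>A. j < k \<longrightarrow> (\<forall>n. j < g n \<longleftrightarrow> k < g n)) \<or>
      (\<forall>j\<in>A. \<forall>k\<in>A. j < k \<longrightarrow> \<not> (\<forall>n. j < g n \<longleftrightarrow> k < g n))"
    using ramsey[of "\<lambda>j k. \<forall>n. j < g n \<longleftrightarrow> k < g n"] by blast
  have unbounded: "\<exists>k\<in>A. m \<le> k" for m
  proof -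
    have "eventually (\<lambda>k. m \<le> k) U"
      using U(2) by (simp add: filter_leD)
    with A have "eventually (\<lambda>k. k \<in> A \<and> m \<le> k) U"
      by (rule eventually_conj)
    then show ?thesis
      using U(1) by (auto simp: ultrafilter_def dest: eventually_happens)
  qed
  have "\<not> (\<forall>j\<in>A. \<forall>k\<in>A. j < k \<longrightarrow> (\<forall>n. j < g n \<longleftrightarrow> k < g n))"
  proof
    assume same: "\<forall>j\<in>A. \<forall>k\<in>A. j < k \<longrightarrow> (\<forall>n. j < g n \<longleftrightarrow> k < g n)"
    obtain j where "j \<in> A" using unbounded by blast
    moreover obtain k where "k \<in> A" "g j \<le> k" using unbounded by blast
    ultimately show False
      using same g_gt[of j] by (metis leD order_less_le_trans)
  qed
  with hom have diff: "\<And>j k. j \<in> A \<Longrightarrow> k \<in> A \<Longrightarrow> j < k \<Longrightarrow> \<not> (\<forall>n. j < g n \<longleftrightarrow> k < g n)"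
    by blast
  define h where "h j = (LEAST i. j < g i)" for j
  have h: "j < g n \<longleftrightarrow> h j \<le> n" for j n
  proof
    show "j < g n \<Longrightarrow> h j \<le> n" by (simp add: h_def Least_le)
    have "j < g (h j)" unfolding h_def by (rule LeastI[of _ j]) (rule g_gt)
    then show "h j \<le> n \<Longrightarrow> j < g n" using g_mono by (meson order_less_le_trans)
  qed
  have inj: "inj_on h A"
  proof (rule inj_onI)
    fix j k assume jk: "j \<in> A" "k \<in> A" "h j = h k"
    then have "\<forall>n. j < g n \<longleftrightarrow> k < g n" by (simp add: h)
    then show "j = k"
      using diff[OF jk(1,2)] diff[OF jk(2,1)] by (metis linorder_neqE_nat)
  qed
  have "card (A \<inter> {..<f n}) \<le> 2 ^ n" for n
  proof -
    have "h ` (A \<inter> {..<f n}) \<subseteq> {..n}"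
      using f_le[of n] h by (auto dest: order_less_le_trans)
    then have "card (h ` (A \<inter> {..<f n})) \<le> card {..n}"
      by (intro card_mono) auto
    also have "card (h ` (A \<inter> {..<f n})) = card (A \<inter> {..<f n})"
      using inj by (intro card_image) (auto intro: inj_on_subset)
    also have "card {..n} \<le> 2 ^ n"
      by (simp add: Suc_leI less_exp)
    finally show ?thesis .
  qed
  with A show "\<exists>A. eventually (\<lambda>k. k \<in> A) U \<and> (\<forall>n. card (A \<inter> {..<f n}) \<le> 2 ^ n)"
    by blast
qed


section \<open>Boolean topological groups\<close>

locale boolean_topological_group = boolean_group G + topological_group G T
  for G (structure) and T
begin

lemma inv_eq_self: "x \<in> carrier G \<Longrightarrow> inv x = x"
  by (simp add: inv_equality square_eq_one)

sublocale comm_group G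
proof (rule group_comm_groupI)
  fix x y assume [simp]: "x \<in> carrier G" "y \<in> carrier G"
  have "inv (x \<otimes> y) = inv y \<otimes> inv x" by (simp add: inv_mult_group)
  then show "x \<otimes> y = y \<otimes> x" by (simp add: inv_eq_self)
qed

lemma mult_cancel: "x \<in> carrier G \<Longrightarrow> y \<in> carrier G \<Longrightarrow> x \<otimes> (x \<otimes> y) = y"
  by (simp add: m_assoc[symmetric] square_eq_one)

lemmas boolean_simps = m_ac square_eq_one mult_cancel

lemma subgroup_mult_cancel:
  assumes "subgroup S G" "x \<in> S" "y \<in> carrier G" "x \<otimes> y \<in> S"
  shows "y \<in> S"
  using subgroup.m_closed[OF assms(1,2,4)] subgroup.mem_carrier[OF assms(1,2)] assms(3)
  by (simp add: mult_cancel)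

text \<open>Translation by \<open>x\<close> is its own inverse, so openness can be tested by moving neighbourhoods of the
  neutral element.\<close>
lemma openin_by_translates:
  assumes "S \<subseteq> carrier G"
    and "\<And>x. x \<in> S \<Longrightarrow> \<exists>V. openin T V \<and> \<one> \<in> V \<and> (\<forall>v\<in>V. x \<otimes> v \<in> S)"
  shows "openin T S"
proof (rule openin_subopen[THEN iffD2], intro ballI)
  fix x assume x: "x \<in> S"
  then obtain V where V: "openin T V" "\<one> \<in> V" "\<And>v. v \<in> V \<Longrightarrow> x \<otimes> v \<in> S"
    using assms(2)[OF x] by blast
  have xc: "x \<in> carrier G" using x assms(1) by blast
  have "continuous_map T (prod_topology T T) (\<lambda>y. (x, y))"
    using xc topspace_eq_carrier by (simp add: continuous_map_pairedI)
  from continuous_map_compose[OF this continuous_mult]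
  have "continuous_map T T (\<lambda>y. x \<otimes> y)" by (simp add: o_def)
  then have "openin T {y \<in> topspace T. x \<otimes> y \<in> V}"
    using V(1) by (rule openin_continuous_map_preimage)
  moreover have "x \<in> {y \<in> topspace T. x \<otimes> y \<in> V}"
    using xc V(2) by (simp add: topspace_eq_carrier square_eq_one)
  moreover have "{y \<in> topspace T. x \<otimes> y \<in> V} \<subseteq> S"
  proof
    fix y assume "y \<in> {y \<in> topspace T. x \<otimes> y \<in> V}"
    then have "y \<in> carrier G" "x \<otimes> (x \<otimes> y) \<in> S"
      using V(3) by (simp_all add: topspace_eq_carrier)
    then show "y \<in> S" using xc by (simp add: mult_cancel)
  qed
  ultimately show "\<exists>W. openin T W \<and> x \<in> W \<and> W \<subseteq> S" by blast
qed

lemma halve_neighbourhood: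
  assumes "openin T U" "\<one> \<in> U"
  obtains V where "openin T V" "\<one> \<in> V" "\<And>x y. x \<in> V \<Longrightarrow> y \<in> V \<Longrightarrow> x \<otimes> y \<in> U"
proof -
  have "openin (prod_topology T T)
      {p \<in> topspace (prod_topology T T). (\<lambda>(x, y). x \<otimes> y) p \<in> U}"
    using continuous_mult assms(1) by (rule openin_continuous_map_preimage)
  moreover have "(\<one>, \<one>) \<in> {p \<in> topspace (prod_topology T T). (\<lambda>(x, y). x \<otimes> y) p \<in> U}"
    using assms(2) by (simp add: topspace_eq_carrier)
  ultimately have "\<exists>V W. openin T V \<and> openin T W \<and> \<one> \<in> V \<and> \<one> \<in> W \<and>
      V \<times> W \<subseteq> {p \<in> topspace (prod_topology T T). (\<lambda>(x, y). x \<otimes> y) p \<in> U}"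
    by (rule openin_prod_topology_alt[THEN iffD1, rule_format])
  then obtain V W where VW: "openin T V" "openin T W" "\<one> \<in> V" "\<one> \<in> W"
    "V \<times> W \<subseteq> {p \<in> topspace (prod_topology T T). (\<lambda>(x, y). x \<otimes> y) p \<in> U}"
    by blast
  show thesis
  proof
    show "openin T (V \<inter> W)" using VW by blast
  qed (use VW in auto)
qed

text \<open>A subgroup \<open>M \<supseteq> H\<close> that is maximal among those missing \<open>g\<close> works: for \<open>x \<notin> M\<close> the subgroup
  \<open>M \<union> (x + M)\<close> contains \<open>g\<close>, so \<open>x\<close> lies in the coset \<open>g + M\<close>.  Index two is what makes finite
  intersections of such subgroups have finite index.\<close>
lemma index_two_subgroup_avoiding:
  assumes H: "open_subgroup H G T" and g: "g \<in> carrier G" "g \<notin> H"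
  obtains M where "open_subgroup M G T" "g \<notin> M"
    "\<And>x y. x \<in> carrier G - M \<Longrightarrow> y \<in> carrier G - M \<Longrightarrow> x \<otimes> y \<in> M"
proof -
  define A where "A = {K. subgroup K G \<and> H \<subseteq> K \<and> g \<notin> K}"
  have "\<exists>M\<in>A. \<forall>X\<in>A. M \<subseteq> X \<longrightarrow> X = M"
  proof (rule subset_Zorn_nonempty)
    show "A \<noteq> {}" using H g by (auto simp: A_def open_subgroup_def)
  next
    fix C assume C: "C \<noteq> {}" "subset.chain A C"
    then have sub: "\<And>K. K \<in> C \<Longrightarrow> subgroup K G \<and> H \<subseteq> K \<and> g \<notin> K"
      and lin: "\<And>K L. K \<in> C \<Longrightarrow> L \<in> C \<Longrightarrow> K \<subseteq> L \<or> L \<subseteq> K"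
      by (auto simp: subset.chain_def A_def)
    have "subgroup (\<Union>C) G"
    proof (rule subgroupI)
      show "\<Union>C \<subseteq> carrier G" using sub subgroup.subset by blast
      show "\<Union>C \<noteq> {}" using C(1) sub subgroup.one_closed by blast
      show "inv a \<in> \<Union>C" if a: "a \<in> \<Union>C" for a
      proof -
        obtain K where K: "K \<in> C" "a \<in> K" using a by blast
        then have "inv a \<in> K" using sub[of K] by (simp add: subgroup.m_inv_closed)
        then show ?thesis using K by blast
      qed
      fix a b assume "a \<in> \<Union>C" "b \<in> \<Union>C"
      then obtain K1 K2 where K12: "K1 \<in> C" "a \<in> K1" "K2 \<in> C" "b \<in> K2" by blast
      then obtain K where K: "K \<in> C" "a \<in> K" "b \<in> K" using lin[of K1 K2] by blast
      then have "a \<otimes> b \<in> K" using sub[of K] by (simp add: subgroup.m_closed)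
      then show "a \<otimes> b \<in> \<Union>C" using K by blast
    qed
    then show "\<Union>C \<in> A" using C(1) sub by (auto simp: A_def)
  qed
  then obtain M where M: "subgroup M G" "H \<subseteq> M" "g \<notin> M"
    and max: "\<And>K. subgroup K G \<Longrightarrow> M \<subseteq> K \<Longrightarrow> g \<notin> K \<Longrightarrow> K = M"
    
  proof -
    obtain M where "M \<in> A" "\<And>K. K \<in> A \<Longrightarrow> M \<subseteq> K \<Longrightarrow> K = M"
      using \<open>\<exists>M\<in>A. \<forall>X\<in>A. M \<subseteq> X \<longrightarrow> X = M\<close> by blast
    then show thesis
      by (intro that[of M]) (auto simp: A_def)
  qed
  have Mc: "x \<in> carrier G" if "x \<in> M" for x
    using subgroup.mem_carrier[OF M(1) that] .
  have "openin T M"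
  proof (rule openin_by_translates)
    show "\<exists>V. openin T V \<and> \<one> \<in> V \<and> (\<forall>v\<in>V. x \<otimes> v \<in> M)" if "x \<in> M" for x
      using H M that by (auto simp: open_subgroup_def intro!: exI[of _ H]
          intro: subgroup.one_closed subgroup.m_closed)
  qed (use Mc in blast)
  moreover have gx: "x \<otimes> g \<in> M" if x: "x \<in> carrier G" "x \<notin> M" for x
  proof -
    define K where "K = M \<union> {x \<otimes> m |m. m \<in> M}"
    have KI: "a \<in> K \<longleftrightarrow> a \<in> carrier G \<and> (a \<in> M \<or> x \<otimes> a \<in> M)" for a
      using x Mc by (auto simp: K_def mult_cancel)
    have "subgroup K G"
    proof (rule subgroupI)
      show "K \<subseteq> carrier G" using KI by blast
      show "K \<noteq> {}" using M(1) subgroup.one_closed K_def by blast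
      show "inv a \<in> K" if "a \<in> K" for a using that KI by (simp add: inv_eq_self)
      fix a b assume "a \<in> K" "b \<in> K"
      then have ab: "a \<in> carrier G" "b \<in> carrier G" "a \<in> M \<or> x \<otimes> a \<in> M" "b \<in> M \<or> x \<otimes> b \<in> M"
        using KI by auto
      have "x \<otimes> (a \<otimes> b) = (x \<otimes> a) \<otimes> b" "x \<otimes> (a \<otimes> b) = a \<otimes> (x \<otimes> b)"
        "a \<otimes> b = (x \<otimes> a) \<otimes> (x \<otimes> b)"
        using ab x by (simp_all add: boolean_simps)
      then show "a \<otimes> b \<in> K"
        using ab subgroup.m_closed[OF M(1)] unfolding KI by (metis m_closed)
    qed
    moreover have "x \<in> K" using x subgroup.one_closed[OF M(1)] by (simp add: KI square_eq_one)
    ultimately have "g \<in> K" using max[of K] x K_def by blast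
    then show ?thesis using KI M(3) by blast
  qed
  moreover have "x \<otimes> y \<in> M" if "x \<in> carrier G - M" "y \<in> carrier G - M" for x y
  proof -
    have "x \<otimes> y = (x \<otimes> g) \<otimes> (y \<otimes> g)" using that g by (simp add: boolean_simps)
    then show ?thesis using gx that M(1) by (simp add: subgroup.m_closed)
  qed
  ultimately show thesis
    using that M by (auto simp: open_subgroup_def)
qed

end

lemma extremally_disconnected_closures_disjoint:
  assumes "extremally_disconnected_space T" "openin T U" "openin T V" "U \<inter> V = {}"
  shows "T closure_of U \<inter> T closure_of V = {}"
proof -
  have "T closure_of U \<inter> V = {}"
    using openin_Int_closure_of_eq_empty[OF assms(3), of U] assms(4) by (simp add: Int_commute)
  moreover have "openin T (T closure_of U)"
    using assms by (simp add: extremally_disconnected_space_def)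
  ultimately show ?thesis
    by (simp add: openin_Int_closure_of_eq_empty)
qed


section \<open>Filtrations by open subgroups\<close>

locale subgroup_filtration = boolean_topological_group +
  fixes L :: "nat \<Rightarrow> 'a set"
  assumes L_subgroup: "subgroup (L n) G"
    and L_open: "openin T (L n)"
    and L_0: "L 0 = carrier G"
    and L_antimono: "m \<le> n \<Longrightarrow> L n \<subseteq> L m"
begin

definition core :: "'a set" where
  "core = (\<Inter>n. L n)"

text \<open>Off the core, \<open>level x\<close> is the last \<open>n\<close> with \<open>x \<in> L n\<close>, an ultrametric valuation; on the core its value
  is arbitrary.\<close>
definition level :: "'a \<Rightarrow> nat" where
  "level x = (LEAST n. x \<notin> L (Suc n))"

lemma core_subgroup: "subgroup core G"
  unfolding core_def using L_subgroup by (intro subgroups_Inter) auto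

lemma core_subset: "core \<subseteq> L n"
  by (auto simp: core_def)

lemma L_carrier: "x \<in> L n \<Longrightarrow> x \<in> carrier G"
  using subgroup.mem_carrier[OF L_subgroup] .

lemma level_iff:
  assumes "x \<in> carrier G - core"
  shows "x \<in> L n \<longleftrightarrow> n \<le> level x"
proof -
  obtain k where "x \<notin> L k" using assms by (auto simp: core_def)
  moreover have "k \<noteq> 0" using calculation assms L_0 by (metis Diff_iff)
  ultimately have "\<exists>k. x \<notin> L (Suc k)" by (metis not0_implies_Suc)
  then have "x \<notin> L (Suc (level x))" unfolding level_def by (rule LeastI_ex)
  moreover have "x \<in> L (Suc k)" if "k < level x" for k
    using that not_less_Least unfolding level_def by blast
  moreover have "x \<in> L 0" using assms L_0 by blast
  ultimately show ?thesis
    using L_antimono[of "Suc (level x)" n]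
    by (metis Suc_le_eq not0_implies_Suc not_less_eq_eq subsetD)
qed

lemma level_mult_deeper:
  assumes x: "x \<in> carrier G - core" and h: "h \<in> L (Suc (level x))"
  shows "x \<otimes> h \<in> carrier G - core" "level (x \<otimes> h) = level x"
proof -
  have hc: "h \<in> carrier G" using h L_carrier by blast
  have iff: "x \<otimes> h \<in> L n \<longleftrightarrow> x \<in> L n" if "n \<le> Suc (level x)" for n
    using h L_antimono[OF that] L_subgroup[of n] hc x subgroup_mult_cancel[of "L n" h x]
    by (auto simp: m_comm intro: subgroup.m_closed)
  have "x \<otimes> h \<notin> L (Suc (level x))" using iff x level_iff by simp
  then show *: "x \<otimes> h \<in> carrier G - core" using x hc core_subset by auto
  have "\<not> Suc (level x) \<le> level (x \<otimes> h)" "level x \<le> level (x \<otimes> h)"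
    using iff[of "Suc (level x)"] iff[of "level x"] x * level_iff by auto
  then show "level (x \<otimes> h) = level x" by simp
qed

lemma openin_level: "openin T {x \<in> carrier G - core. P (level x)}"
proof (rule openin_by_translates)
  fix x assume "x \<in> {x \<in> carrier G - core. P (level x)}"
  then show "\<exists>V. openin T V \<and> \<one> \<in> V \<and> (\<forall>v\<in>V. x \<otimes> v \<in> {x \<in> carrier G - core. P (level x)})"
    using level_mult_deeper[of x] L_open subgroup.one_closed[OF L_subgroup]
    by (intro exI[of _ "L (Suc (level x))"]) auto
qed auto

text \<open>The distribution of the levels of the points of \<open>E\<close> close to the neutral element.\<close>
definition level_filter :: "'a set \<Rightarrow> nat filter" where
  "level_filter E = filtermap level (atin_within T \<one> E)"

lemma eventually_level_filter:
  assumes "E \<subseteq> carrier G - core"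
  shows "eventually P (level_filter E) \<longleftrightarrow>
    (\<exists>V. openin T V \<and> \<one> \<in> V \<and> (\<forall>x\<in>V \<inter> E. P (level x)))"
proof -
  have "\<one> \<notin> E" using assms subgroup.one_closed[OF core_subgroup] by blast
  then show ?thesis
    unfolding level_filter_def eventually_filtermap eventually_atin_within
    by (auto simp: topspace_eq_carrier)
qed

lemma level_filter_le_sequentially:
  assumes "E \<subseteq> carrier G - core"
  shows "level_filter E \<le> sequentially"
  unfolding le_sequentially
proof
  fix n
  show "eventually (\<lambda>k. n \<le> k) (level_filter E)"
    unfolding eventually_level_filter[OF assms]
    using L_open subgroup.one_closed[OF L_subgroup] level_iff assms
    by (intro exI[of _ "L n"]) auto
qed

text \<open>The points off the core whose level satisfies \<open>P\<close>, and those whose level does not, form two disjoint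
  open sets; the neutral element is in the closure of at most one of them.\<close>
lemma ultrafilter_level_filter:
  assumes ed: "extremally_disconnected_space T"
    and E: "E \<subseteq> carrier G - core" and cl: "\<one> \<in> T closure_of E"
  shows "ultrafilter (level_filter E)"
  unfolding ultrafilter_def
proof (intro conjI allI)
  show "level_filter E \<noteq> bot"
    using cl unfolding trivial_limit_def eventually_level_filter[OF E] in_closure_of by auto
  fix P
  let ?O = "\<lambda>Q. {x \<in> carrier G - core. Q (level x)}"
  have "T closure_of ?O P \<inter> T closure_of ?O (\<lambda>n. \<not> P n) = {}"
    by (intro extremally_disconnected_closures_disjoint[OF ed] openin_level) auto
  then have "\<one> \<notin> T closure_of ?O P \<or> \<one> \<notin> T closure_of ?O (\<lambda>n. \<not> P n)"
    by blast
  moreover have "eventually (\<lambda>n. \<not> Q n) (level_filter E)" if Q: "\<one> \<notin> T closure_of ?O Q" for Q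
  proof -
    obtain V where "openin T V" "\<one> \<in> V" "V \<inter> ?O Q = {}"
      using Q by (auto simp: in_closure_of topspace_eq_carrier)
    then show ?thesis
      using E unfolding eventually_level_filter[OF E] by (intro exI[of _ V]) blast
  qed
  ultimately show "eventually P (level_filter E) \<or> eventually (\<lambda>n. \<not> P n) (level_filter E)"
    by fastforce
qed

text \<open>The two hypotheses on \<open>E\<close> let a product \<open>x \<otimes> y\<close> with \<open>level x < level y\<close> remember both levels: its own level is
  that of \<open>x\<close>, and by the gap the factor \<open>y\<close> lies deep enough not to confuse \<open>x\<close> with another point of \<open>E\<close> on
  the same level, so \<open>y\<close> can be recovered up to the core.\<close>
lemma level_filter_ramsey:
  assumes ed: "extremally_disconnected_space T"
    and E: "E \<subseteq> carrier G - core"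
    and separated: "\<And>x y. x \<in> E \<Longrightarrow> y \<in> E \<Longrightarrow> level x = level y \<Longrightarrow>
      x \<otimes> y \<in> L (Suc (Suc (level x))) \<Longrightarrow> x \<otimes> y \<in> core"
    and gaps: "\<And>x y. x \<in> E \<Longrightarrow> y \<in> E \<Longrightarrow> level x < level y \<Longrightarrow> Suc (Suc (level x)) \<le> level y"
  shows "\<exists>A. eventually (\<lambda>k. k \<in> A) (level_filter E) \<and>
    ((\<forall>j\<in>A. \<forall>k\<in>A. j < k \<longrightarrow> P j k) \<or> (\<forall>j\<in>A. \<forall>k\<in>A. j < k \<longrightarrow> \<not> P j k))"
proof -
  \<comment> \<open>The products with colour \<open>Q\<close>, thickened to an open set: \<open>x \<otimes> y\<close> times the subgroup just below the level of \<open>y\<close>.\<close>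
  define W where "W Q = {t \<in> carrier G. \<exists>x\<in>E. \<exists>y\<in>E. level x < level y \<and> Q (level x) (level y) \<and>
    x \<otimes> y \<otimes> t \<in> L (Suc (level y))}" for Q
  have Ec: "x \<in> carrier G" if "x \<in> E" for x using E that by blast
  have W_open: "openin T (W Q)" for Q
  proof (rule openin_by_translates)
    fix t assume "t \<in> W Q"
    then obtain x y where t: "t \<in> carrier G" and xy: "x \<in> E" "y \<in> E" "level x < level y"
      "Q (level x) (level y)" "x \<otimes> y \<otimes> t \<in> L (Suc (level y))"
      by (auto simp: W_def)
    have "t \<otimes> v \<in> W Q" if v: "v \<in> L (Suc (level y))" for v
    proof -
      have "x \<otimes> y \<otimes> (t \<otimes> v) = (x \<otimes> y \<otimes> t) \<otimes> v"
        using t xy Ec L_carrier[OF v] by (simp add: m_assoc)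
      then have "x \<otimes> y \<otimes> (t \<otimes> v) \<in> L (Suc (level y))"
        using xy(5) v L_subgroup subgroup.m_closed by metis
      then show ?thesis
        using xy t L_carrier[OF v] by (auto simp: W_def)
    qed
    then show "\<exists>V. openin T V \<and> \<one> \<in> V \<and> (\<forall>v\<in>V. t \<otimes> v \<in> W Q)"
      using L_open subgroup.one_closed[OF L_subgroup] by blast
  qed (auto simp: W_def)
  \<comment> \<open>The thickening is absorbed into the second factor, which keeps its level but may leave \<open>E\<close>.\<close>
  have factor: "\<exists>x z. x \<in> E \<and> z \<in> carrier G - core \<and> level x < level z \<and>
      Suc (Suc (level x)) \<le> level z \<and> Q (level x) (level z) \<and> t = x \<otimes> z \<and> level t = level x"
    if tW: "t \<in> W Q" for Q t
  proof -
    obtain x y where t: "t \<in> carrier G" and xy: "x \<in> E" "y \<in> E" "level x < level y"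
      "Q (level x) (level y)" and h: "x \<otimes> y \<otimes> t \<in> L (Suc (level y))"
      using tW by (auto simp: W_def)
    define z where "z = y \<otimes> (x \<otimes> y \<otimes> t)"
    have z: "z \<in> carrier G - core" "level z = level y"
      using level_mult_deeper[OF _ h] E xy by (auto simp: z_def)
    have txz: "t = x \<otimes> z"
      using t xy Ec by (simp add: z_def boolean_simps)
    have "z \<in> L (Suc (level x))" using level_iff z xy by simp
    then have "level t = level x"
      using level_mult_deeper E xy txz by blast
    with z txz xy gaps[OF xy(1-3)] show ?thesis
      by (intro exI[of _ x] exI[of _ z]) auto
  qed
  have W_disjoint: "W P \<inter> W (\<lambda>j k. \<not> P j k) = {}"
  proof (rule ccontr)
    assume "W P \<inter> W (\<lambda>j k. \<not> P j k) \<noteq> {}"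
    then obtain t where t: "t \<in> W P" "t \<in> W (\<lambda>j k. \<not> P j k)" by blast
    obtain x z where xz: "x \<in> E" "z \<in> carrier G - core" "level x < level z"
      "Suc (Suc (level x)) \<le> level z" "P (level x) (level z)" "t = x \<otimes> z" "level t = level x"
      using factor[OF t(1)] by blast
    obtain x' z' where xz': "x' \<in> E" "z' \<in> carrier G - core" "level x' < level z'"
      "Suc (Suc (level x')) \<le> level z'" "\<not> P (level x') (level z')" "t = x' \<otimes> z'" "level t = level x'"
      using factor[OF t(2)] by blast
    have c: "x \<in> carrier G" "x' \<in> carrier G" "z \<in> carrier G" "z' \<in> carrier G"
      using xz xz' Ec by auto
    have "x \<otimes> z \<otimes> (x' \<otimes> z) = x' \<otimes> z' \<otimes> (x' \<otimes> z)" using xz xz' by simp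
    then have eq: "x \<otimes> x' = z \<otimes> z'" using c by (simp add: boolean_simps)
    have lev: "level x = level x'" using xz xz' by simp
    have "z \<in> L (Suc (Suc (level x)))" "z' \<in> L (Suc (Suc (level x)))"
      using level_iff xz xz' lev by auto
    then have "x \<otimes> x' \<in> L (Suc (Suc (level x)))"
      unfolding eq using L_subgroup subgroup.m_closed by metis
    then have "z \<otimes> z' \<in> core"
      using separated xz xz' lev eq by metis
    then have "level (z \<otimes> (z \<otimes> z')) = level z"
      using level_mult_deeper(2)[OF xz(2)] core_subset by blast
    then have "level z' = level z" using c by (simp add: mult_cancel)
    then show False using xz xz' lev by simp
  qed
  have avoid: "\<exists>A. eventually (\<lambda>k. k \<in> A) (level_filter E) \<and> (\<forall>j\<in>A. \<forall>k\<in>A. j < k \<longrightarrow> \<not> Q j k)"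
    if notcl: "\<one> \<notin> T closure_of W Q" for Q
  proof -
    obtain U where U: "openin T U" "\<one> \<in> U" "U \<inter> W Q = {}"
      using notcl by (auto simp: in_closure_of topspace_eq_carrier)
    obtain V where V: "openin T V" "\<one> \<in> V" "\<And>x y. x \<in> V \<Longrightarrow> y \<in> V \<Longrightarrow> x \<otimes> y \<in> U"
      using halve_neighbourhood[OF U(1,2)] by blast
    have "\<not> Q (level x) (level y)" if "x \<in> V \<inter> E" "y \<in> V \<inter> E" "level x < level y" for x y
    proof
      assume "Q (level x) (level y)"
      moreover have "x \<otimes> y \<otimes> (x \<otimes> y) \<in> L (Suc (level y))"
        using that Ec subgroup.one_closed[OF L_subgroup] by (simp add: square_eq_one)
      ultimately have "x \<otimes> y \<in> W Q"
        using that Ec unfolding W_def by blast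
      then show False using V(3) that U(3) by blast
    qed
    moreover have "eventually (\<lambda>k. k \<in> level ` (V \<inter> E)) (level_filter E)"
      unfolding eventually_level_filter[OF E] using V by blast
    ultimately show ?thesis by blast
  qed
  have "\<one> \<notin> T closure_of W P \<or> \<one> \<notin> T closure_of W (\<lambda>j k. \<not> P j k)"
    using extremally_disconnected_closures_disjoint[OF ed W_open W_open W_disjoint] by blast
  then show ?thesis using avoid by fastforce
qed

text \<open>As only finitely many cosets of the core are met by \<open>D\<close> outside each \<open>L n\<close>, the filtration has a subsequence along which the sets \<open>D - L n\<close> are separated modulo the
  core by the next subgroup.\<close>
lemma rapid_ultrafilter_if_null_set_accumulates:
  assumes ed: "extremally_disconnected_space T"
    and D: "D \<subseteq> carrier G - core" and cl: "\<one> \<in> T closure_of D"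
    and null: "\<And>n. \<exists>R. finite R \<and> R \<subseteq> carrier G \<and> (\<forall>x\<in>D - L n. \<exists>r\<in>R. x \<otimes> r \<in> core)"
  shows "\<exists>U :: nat filter. rapid_ultrafilter U"
proof -
  have "\<exists>m>n. \<forall>x\<in>D - L n. \<forall>y\<in>D - L n. x \<otimes> y \<in> L m \<longrightarrow> x \<otimes> y \<in> core" for n
  proof -
    obtain R where R: "finite R" "R \<subseteq> carrier G" "\<And>x. x \<in> D - L n \<Longrightarrow> \<exists>r\<in>R. x \<otimes> r \<in> core"
      using null[of n] by blast
    \<comment> \<open>The finitely many nontrivial differences of representatives; each is missed by some \<open>L k\<close>.\<close>
    define Q where "Q = (\<lambda>(r, s). r \<otimes> s) ` (R \<times> R) - core"
    have "\<forall>q\<in>Q. \<exists>k. q \<notin> L k" by (auto simp: Q_def core_def)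
    then obtain \<nu> where \<nu>: "\<And>q. q \<in> Q \<Longrightarrow> q \<notin> L (\<nu> q)" by metis
    have fin: "finite Q" using R(1) by (auto simp: Q_def)
    define m where "m = Max (insert (Suc n) (\<nu> ` Q))"
    have mge: "\<nu> q \<le> m" if "q \<in> Q" for q
      using that fin by (simp add: m_def)
    have "Suc n \<le> m" using fin by (simp add: m_def)
    moreover have "x \<otimes> y \<in> core" if xy: "x \<in> D - L n" "y \<in> D - L n" "x \<otimes> y \<in> L m" for x y
    proof -
      obtain r s where rs: "r \<in> R" "s \<in> R" "x \<otimes> r \<in> core" "y \<otimes> s \<in> core" using R(3) xy by meson
      have c: "x \<in> carrier G" "y \<in> carrier G" "r \<in> carrier G" "s \<in> carrier G" using xy D R rs by auto
      have "r \<otimes> s = (x \<otimes> y) \<otimes> ((x \<otimes> r) \<otimes> (y \<otimes> s))" using c by (simp add: boolean_simps)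
      moreover have k: "(x \<otimes> r) \<otimes> (y \<otimes> s) \<in> core"
        using rs core_subgroup subgroup.m_closed by metis
      ultimately have "r \<otimes> s \<in> L m"
        using core_subset L_subgroup[of m] subgroup.m_closed xy(3) by (metis subsetD)
      then have "r \<otimes> s \<notin> Q" using \<nu> mge L_antimono by blast
      then have "r \<otimes> s \<in> core" using rs by (auto simp: Q_def)
      moreover have "x \<otimes> y = ((x \<otimes> r) \<otimes> (y \<otimes> s)) \<otimes> (r \<otimes> s)" using c by (simp add: boolean_simps)
      ultimately show ?thesis using k core_subgroup subgroup.m_closed by metis
    qed
    ultimately show ?thesis by (intro exI[of _ m]) auto
  qed
  then obtain nx where nx: "\<And>n. n < nx n"
    "\<And>n x y. x \<in> D - L n \<Longrightarrow> y \<in> D - L n \<Longrightarrow> x \<otimes> y \<in> L (nx n) \<Longrightarrow> x \<otimes> y \<in> core"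
    by metis
  define a where "a = rec_nat 0 (\<lambda>_. nx)"
  have a: "a 0 = 0" "a (Suc j) = nx (a j)" for j by (simp_all add: a_def)
  have mono: "strict_mono a" by (simp add: strict_mono_Suc_iff a nx)
  interpret F: subgroup_filtration G T "\<lambda>j. L (a j)"
    by (intro subgroup_filtration.intro subgroup_filtration_axioms.intro boolean_topological_group_axioms)
      (use L_subgroup L_open L_0 a L_antimono mono in \<open>auto simp: strict_mono_less_eq\<close>)
  have core_eq: "F.core = core"
  proof
    show "F.core \<subseteq> core"
      using L_antimono[OF strict_mono_imp_increasing[OF mono]] by (auto simp: F.core_def core_def)
  qed (auto simp: F.core_def core_def)
  \<comment> \<open>Keeping the levels of one parity creates the gaps: distinct levels are at least two apart.\<close>
  define E where "E i = {x \<in> D. F.level x mod 2 = i}" for i :: nat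
  have "D = E 0 \<union> E 1" by (auto simp: E_def)
  then obtain i where i: "\<one> \<in> T closure_of E i"
    using cl by (metis closure_of_Un UnE)
  have E: "E i \<subseteq> carrier G - F.core" using D core_eq by (auto simp: E_def)
  have "rapid_ultrafilter (F.level_filter (E i))"
  proof (intro rapid_ultrafilter_if_ramsey F.level_filter_ramsey
      F.ultrafilter_level_filter F.level_filter_le_sequentially ed E i)
    fix x y assume xy: "x \<in> E i" "y \<in> E i"
    {
      assume lev: "F.level x = F.level y" and prod: "x \<otimes> y \<in> L (a (Suc (Suc (F.level x))))"
      have "x \<in> D - L (a (Suc (F.level x)))" "y \<in> D - L (a (Suc (F.level x)))"
        using F.level_iff[of _ "Suc (F.level x)"] E xy lev by (auto simp: E_def)
      then show "x \<otimes> y \<in> F.core"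
        using nx(2) prod core_eq a(2) by metis
    next
      assume "F.level x < F.level y"
      moreover have "F.level x mod 2 = F.level y mod 2"
        using xy by (simp add: E_def)
      ultimately show "Suc (Suc (F.level x)) \<le> F.level y"
        by presburger
    }
  qed
  then show ?thesis by blast
qed

text \<open>The hypothesis \<open>index\<close> expresses that \<open>L n\<close> has index at most \<open>2 ^ n\<close>, in the pigeonhole form in which it is
  applied.\<close>
lemma exists_rapid_ultrafilter:
  assumes ed: "extremally_disconnected_space T" and count: "countable (carrier G)"
    and nowhere: "T interior_of core = {}"
    and index: "\<And>n K. K \<subseteq> carrier G \<Longrightarrow> 2 ^ n < card K \<Longrightarrow> \<exists>x\<in>K. \<exists>y\<in>K. x \<noteq> y \<and> x \<otimes> y \<in> L n"
  shows "\<exists>U :: nat filter. rapid_ultrafilter U"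
proof -
  define e where "e = from_nat_into (carrier G)"
  have ec: "e i \<in> carrier G" for i unfolding e_def by (rule from_nat_into) auto
  \<comment> \<open>The code of the coset of \<open>x\<close> modulo the core: the number of its first element in the enumeration \<open>e\<close>.\<close>
  define c where "c x = (LEAST i. x \<otimes> e i \<in> core)" for x
  have cE: "x \<otimes> e (c x) \<in> core" if "x \<in> carrier G" for x
  proof -
    obtain i where "e i = x" using from_nat_into_surj[OF count \<open>x \<in> carrier G\<close>] by (auto simp: e_def)
    then have "x \<otimes> e i \<in> core"
      using that square_eq_one subgroup.one_closed[OF core_subgroup] by simp
    then show ?thesis unfolding c_def by (rule LeastI)
  qed
  have c_eq: "c x = c y \<longleftrightarrow> x \<otimes> y \<in> core" if "x \<in> carrier G" "y \<in> carrier G" for x y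
  proof
    assume "c x = c y"
    moreover have "x \<otimes> y = (x \<otimes> e (c x)) \<otimes> (y \<otimes> e (c x))" using that ec by (simp add: boolean_simps)
    ultimately show "x \<otimes> y \<in> core" using cE that core_subgroup subgroup.m_closed by metis
  next
    assume xy: "x \<otimes> y \<in> core"
    have "x \<otimes> e i \<in> core \<longleftrightarrow> y \<otimes> e i \<in> core" for i
    proof -
      have "x \<otimes> e i = (x \<otimes> y) \<otimes> (y \<otimes> e i)" "y \<otimes> e i = (x \<otimes> y) \<otimes> (x \<otimes> e i)"
        using that ec by (simp_all add: boolean_simps)
      then show ?thesis using xy core_subgroup subgroup.m_closed by metis
    qed
    then show "c x = c y" by (simp add: c_def)
  qed
  define F where "F = filtermap c (atin_within T \<one> (carrier G - core))"
  have evF: "eventually P F \<longleftrightarrow> (\<exists>V. openin T V \<and> \<one> \<in> V \<and> (\<forall>x\<in>V - core. P (c x)))" for P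
  proof -
    have "(\<forall>x\<in>V. x \<in> carrier G - core \<and> x \<noteq> \<one> \<longrightarrow> P (c x)) \<longleftrightarrow> (\<forall>x\<in>V - core. P (c x))"
      if "openin T V" for V
      using openin_subset[OF that] subgroup.one_closed[OF core_subgroup] topspace_eq_carrier by auto
    then show ?thesis
      unfolding F_def eventually_filtermap eventually_atin_within
      by (simp only: topspace_eq_carrier one_closed simp_thms cong: conj_cong)
  qed
  have "F \<noteq> bot"
  proof
    assume "F = bot"
    then have "eventually (\<lambda>_. False) F" by simp
    then obtain V where "openin T V" "\<one> \<in> V" "V \<subseteq> core" unfolding evF by auto
    then show False using nowhere by (auto simp: interior_of_def)
  qed
  have F_seq: "F \<le> sequentially"
    unfolding le_sequentially
  proof
    fix m
    have "\<exists>k. e i \<in> core \<or> e i \<notin> L k" for i by (auto simp: core_def)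
    then obtain k where k: "\<And>i. e i \<in> core \<or> e i \<notin> L (k i)" by metis
    define n where "n = (\<Sum>i<m. k i)"
    have kn: "k i \<le> n" if "i < m" for i
      unfolding n_def using that by (intro member_le_sum) auto
    have "m \<le> c x" if x: "x \<in> L n - core" for x
    proof (rule ccontr)
      assume "\<not> m \<le> c x"
      then have "L n \<subseteq> L (k (c x))" using kn L_antimono by simp
      moreover have xc: "x \<in> carrier G" using x L_carrier[of x n] by simp
      have "e (c x) \<in> L n"
      proof (rule subgroup_mult_cancel[OF L_subgroup _ ec])
        show "x \<in> L n" using x by simp
        show "x \<otimes> e (c x) \<in> L n" using cE[OF xc] core_subset[of n] by (rule rev_subsetD)
      qed
      ultimately have "e (c x) \<in> core" using k[of "c x"] by blast
      then have "x \<in> core"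
      proof (rule subgroup_mult_cancel[OF core_subgroup _ xc])
        show "e (c x) \<otimes> x \<in> core" using cE[OF xc] by (simp add: m_comm[OF ec xc])
      qed
      then show False using x by simp
    qed
    then show "eventually (\<lambda>k. m \<le> k) F"
      unfolding evF using L_open subgroup.one_closed[OF L_subgroup] by (intro exI[of _ "L n"]) auto
  qed
  show ?thesis
  proof (cases "\<forall>f :: nat \<Rightarrow> nat. \<exists>A. eventually (\<lambda>k. k \<in> A) F \<and> (\<forall>n. card (A \<inter> {..<f n}) \<le> 2 ^ n)")
    case True
    obtain U where U: "ultrafilter U" "U \<le> F"
      using ultrafilter_extension[OF \<open>F \<noteq> bot\<close>] by blast
    have "rapid_ultrafilter U"
    proof (rule rapid_ultrafilter_if_slow_sets[OF U(1)])
      show "U \<le> sequentially" using U(2) F_seq by (rule order_trans)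
      show "\<exists>A. eventually (\<lambda>k. k \<in> A) U \<and> (\<forall>n. card (A \<inter> {..<f n}) \<le> 2 ^ n)"
        for f :: "nat \<Rightarrow> nat"
        using True filter_leD[OF U(2)] by meson
    qed
    then show ?thesis by blast
  next
    case False
    then obtain f where f: "\<And>A. eventually (\<lambda>k. k \<in> A) F \<Longrightarrow> \<exists>n. 2 ^ n < card (A \<inter> {..<f n :: nat})"
      by (meson not_le)
    \<comment> \<open>Distinct codes keep the differences off the core.\<close>
    define D where "D = {x \<otimes> y |x y. x \<in> carrier G \<and> y \<in> carrier G \<and> c x \<noteq> c y \<and>
      (\<exists>n. c x < f n \<and> c y < f n \<and> x \<otimes> y \<in> L n)}"
    show ?thesis
    proof (rule rapid_ultrafilter_if_null_set_accumulates[OF ed, of D])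
      show "D \<subseteq> carrier G - core" using c_eq by (auto simp: D_def)
    next
      show "\<one> \<in> T closure_of D"
        unfolding in_closure_of
      proof (intro conjI allI impI)
        show "\<one> \<in> topspace T" by (simp add: topspace_eq_carrier)
        fix U assume "\<one> \<in> U \<and> openin T U"
        then obtain V where V: "openin T V" "\<one> \<in> V" "\<And>x y. x \<in> V \<Longrightarrow> y \<in> V \<Longrightarrow> x \<otimes> y \<in> U"
          using halve_neighbourhood by blast
        have Vc: "V \<subseteq> carrier G" using openin_subset[OF V(1)] by (simp add: topspace_eq_carrier)
        have "eventually (\<lambda>k. k \<in> c ` (V - core)) F" unfolding evF using V by blast
        then obtain n where n: "2 ^ n < card (c ` (V - core) \<inter> {..<f n})" using f by blast
        \<comment> \<open>One point for each code, so that the pigeonhole principle yields points with distinct codes.\<close>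
        obtain K where K: "K \<subseteq> {x \<in> V - core. c x < f n}" "inj_on c K"
          "c ` K = c ` {x \<in> V - core. c x < f n}"
          using subset_image_inj[of "c ` {x \<in> V - core. c x < f n}" c "{x \<in> V - core. c x < f n}"]
          by auto
        have "c ` {x \<in> V - core. c x < f n} = c ` (V - core) \<inter> {..<f n}" by auto
        then have "2 ^ n < card K" using n K card_image by metis
        then obtain x y where xy: "x \<in> K" "y \<in> K" "x \<noteq> y" "x \<otimes> y \<in> L n"
          using index[of K n] K(1) Vc by blast
        then have "c x \<noteq> c y" using K(2) inj_onD by metis
        then have "x \<otimes> y \<in> D" using xy K(1) Vc by (fastforce simp: D_def)
        then show "\<exists>y. y \<in> D \<and> y \<in> U" using V(3) xy K(1) by blast
      qed
    next
      fix n
      \<comment> \<open>A difference outside \<open>L n\<close> comes from a stage \<open>m < n\<close>, so both of its codes are below \<open>N\<close>.\<close>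
      define N where "N = (\<Sum>m<n. f m)"
      have fN: "f m \<le> N" if "m < n" for m
        unfolding N_def using that by (intro member_le_sum) auto
      define R where "R = (\<lambda>(i, j). e i \<otimes> e j) ` ({..<N} \<times> {..<N})"
      have "\<exists>r\<in>R. d \<otimes> r \<in> core" if d: "d \<in> D - L n" for d
      proof -
        obtain x y m where xy: "d = x \<otimes> y" "x \<in> carrier G" "y \<in> carrier G" "c x < f m" "c y < f m"
          "x \<otimes> y \<in> L m"
          using d by (auto simp: D_def)
        have "m < n" using xy(1,6) d L_antimono[of n m] by (meson DiffD2 not_le subsetD)
        then have "c x < N" "c y < N" using fN[of m] xy by auto
        then have "e (c x) \<otimes> e (c y) \<in> R" by (auto simp: R_def)
        moreover have "d \<otimes> (e (c x) \<otimes> e (c y)) = (x \<otimes> e (c x)) \<otimes> (y \<otimes> e (c y))"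
          using xy ec by (simp add: boolean_simps)
        then have "d \<otimes> (e (c x) \<otimes> e (c y)) \<in> core"
          using cE xy core_subgroup subgroup.m_closed by metis
        ultimately show ?thesis by blast
      qed
      then show "\<exists>R. finite R \<and> R \<subseteq> carrier G \<and> (\<forall>x\<in>D - L n. \<exists>r\<in>R. x \<otimes> r \<in> core)"
        using ec by (intro exI[of _ R]) (auto simp: R_def)
    qed
  qed
qed

end

section \<open>A filtration of finite index from open subgroups\<close>

theorem mainTheorem1:
  fixes G :: "('a, 'b) monoid_scheme" and T :: "'a topology" and \<H> :: "'a set set"
  assumes "boolean_group G" and "topological_group G T"
    and "countable (carrier G)"
    and "Hausdorff_space T" and "extremally_disconnected_space T"
    and "\<And>H. H \<in> \<H> \<Longrightarrow> open_subgroup H G T"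
    and "T interior_of (carrier G \<inter> \<Inter>\<H>) = {}"
  shows "\<exists>U :: nat filter. rapid_ultrafilter U"
proof -
  interpret boolean_topological_group G T
    using assms(1,2) by (rule boolean_topological_group.intro)
  define X where "X = carrier G - \<Inter>\<H>"
  have "X \<noteq> {}"
  proof
    assume "X = {}"
    then have "carrier G \<inter> \<Inter>\<H> = topspace T" by (auto simp: X_def topspace_eq_carrier)
    then show False using assms(7) topspace_eq_carrier one_closed by (metis empty_iff interior_of_topspace)
  qed
  define x where "x = from_nat_into X"
  have xX: "range x = X"
    unfolding x_def using \<open>X \<noteq> {}\<close> assms(3) by (intro range_from_nat_into) (auto simp: X_def)
  have "\<exists>M. open_subgroup M G T \<and> x i \<notin> M \<and>
      (\<forall>a\<in>carrier G - M. \<forall>b\<in>carrier G - M. a \<otimes>\<^bsub>G\<^esub> b \<in> M)" for i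
  proof -
    have "x i \<in> X" using xX by blast
    then obtain H where "H \<in> \<H>" "x i \<in> carrier G" "x i \<notin> H" by (auto simp: X_def)
    then show ?thesis using index_two_subgroup_avoiding[of H "x i"] assms(6) by metis
  qed
  then obtain M where M: "\<And>i. open_subgroup (M i) G T" "\<And>i. x i \<notin> M i"
    "\<And>i a b. a \<in> carrier G - M i \<Longrightarrow> b \<in> carrier G - M i \<Longrightarrow> a \<otimes>\<^bsub>G\<^esub> b \<in> M i"
    by metis
  have Msub: "subgroup (M i) G" "openin T (M i)" for i using M(1) by (auto simp: open_subgroup_def)
  define L where "L n = {a \<in> carrier G. \<forall>i<n. a \<in> M i}" for n
  have L_subgroup: "subgroup (L n) G" for n
    by (rule subgroupI)
      (use Msub in \<open>auto simp: L_def intro: subgroup.m_closed subgroup.m_inv_closed subgroup.one_closed\<close>)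
  have L_open: "openin T (L n)" for n
  proof (induction n)
    case 0
    then show ?case using openin_topspace[of T] by (simp add: L_def topspace_eq_carrier)
  next
    case (Suc n)
    have "L (Suc n) = L n \<inter> M n" by (auto simp: L_def less_Suc_eq)
    then show ?case using Suc Msub by auto
  qed
  interpret subgroup_filtration G T L
    by (intro subgroup_filtration.intro subgroup_filtration_axioms.intro boolean_topological_group_axioms)
      (use L_subgroup L_open in \<open>auto simp: L_def\<close>)
  show ?thesis
  proof (rule exists_rapid_ultrafilter[OF assms(5,3)])
    have "core \<subseteq> carrier G \<inter> \<Inter>\<H>"
    proof
      fix a assume a: "a \<in> core"
      then have "a \<in> L n" for n by (auto simp: core_def)
      then have "a \<in> carrier G" "a \<in> M i" for i by (auto simp: L_def)
      then have "a \<in> carrier G" "a \<notin> range x" using M(2) by auto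
      then show "a \<in> carrier G \<inter> \<Inter>\<H>" using xX X_def by blast
    qed
    then show "T interior_of core = {}" using assms(7) interior_of_mono by blast
  next
    fix n K assume K: "K \<subseteq> carrier G" "2 ^ n < card K"
    \<comment> \<open>Points with the same trace on the first \<open>n\<close> subgroups differ by an element of \<open>L n\<close>, and there are \<open>2 ^ n\<close> traces.\<close>
    define \<sigma> where "\<sigma> a = {i. i < n \<and> a \<in> M i}" for a
    have "\<sigma> ` K \<subseteq> Pow {..<n}" by (auto simp: \<sigma>_def)
    then have "card (\<sigma> ` K) \<le> 2 ^ n" by (metis card_Pow card_lessThan card_mono finite_Pow_iff finite_lessThan)
    then have "\<not> inj_on \<sigma> K" using K(2) by (intro pigeonhole) simp
    then obtain a b where ab: "a \<in> K" "b \<in> K" "\<sigma> a = \<sigma> b" "a \<noteq> b" by (auto simp: inj_on_def)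
    have c: "a \<in> carrier G" "b \<in> carrier G" using ab K by auto
    have "a \<otimes>\<^bsub>G\<^esub> b \<in> M i" if "i < n" for i
    proof -
      have "a \<in> M i \<longleftrightarrow> b \<in> M i" using ab(3) that by (auto simp: \<sigma>_def)
      then show ?thesis using c M(3) subgroup.m_closed[OF Msub(1)] by blast
    qed
    then have "a \<otimes>\<^bsub>G\<^esub> b \<in> L n" using c by (auto simp: L_def)
    then show "\<exists>a\<in>K. \<exists>b\<in>K. a \<noteq> b \<and> a \<otimes>\<^bsub>G\<^esub> b \<in> L n" using ab by blast
  qed
qed

end
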